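(* Fix $p\in[\frac12,1)$, let $q:=1-p$, and let $d$ be a positive integer. Let $(S_n)_{n\ge 0}$ be the simple random walk on $\mathbb{Z}$ with $S_0=0$ and mutually independent increments $X_n=S_n-S_{n-1}$ satisfying $\mathbb{P}[X_n=+1]=p$ and $\mathbb{P}[X_n=-1]=q$ for $n\ge 1$. Let $R_n:=\#\{1\le k\le n: X_k=+1\}$ and $N_d:=\inf\{n\ge 0: S_n=d\}$. Then $$ \mathbb{E}\left[\frac{R_{N_d}}{N_d}\right] =(-1)^{(d-1)/2}\,d\left(\frac{p}{q}\right)^{d/2}\arctan\left(\sqrt{\frac{q}{p}}\right)+1-d\sum_{k=0}^{(d-1)/2}\frac{(-1)^k}{d-2k}\left(\frac{p}{q}\right)^k $$ for $d$ odd, and $$ \mathbb{E}\left[\frac{R_{N_d}}{N_d}\right] =(-1)^{d/2}\,\frac{d}{2}\left(\frac{p}{q}\right)^{d/2}(\ln p)+1-\frac{d}{2}\left(\frac{p}{q}\right)^{d/2}\sum_{k=1}^{d/2}(-1)^{(d/2)+k}\binom{d/2}{k}\frac{p^{-k}-1}{k} $$ for $d$ even.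
   Context: For $p\ge \frac12$, the hitting time $N_d$ is almost surely finite, so $R_{N_d}/N_d$ is almost surely well defined (its value on the null event $\{N_d=\infty\}$ is irrelevant). $R_{N_d}$ denotes $R_n$ evaluated at $n=N_d$. *)

theory Defs
  imports "HOL-Probability.Probability"
begin

definition increment :: "(nat \<Rightarrow> 'a \<Rightarrow> int) \<Rightarrow> nat \<Rightarrow> 'a \<Rightarrow> int" where
  "increment S n \<omega> = S n \<omega> - S (n - 1) \<omega>"

(* Only the increments with index n \<ge> 1 are meaningful; increment S 0 is the zero function. *)
locale simple_random_walk = prob_space M for M :: "'a measure" +
  fixes S :: "nat \<Rightarrow> 'a \<Rightarrow> int" and p :: real
  assumes start: "\<And>\<omega>. \<omega> \<in> space M \<Longrightarrow> S 0 \<omega> = 0"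
    and indep_increments: "indep_vars (\<lambda>_. count_space UNIV) (increment S) {1..}"
    and prob_up: "\<And>n. n \<ge> 1 \<Longrightarrow> prob {\<omega> \<in> space M. increment S n \<omega> = 1} = p"
    and prob_down: "\<And>n. n \<ge> 1 \<Longrightarrow> prob {\<omega> \<in> space M. increment S n \<omega> = -1} = 1 - p"

definition right_steps :: "(nat \<Rightarrow> 'a \<Rightarrow> int) \<Rightarrow> nat \<Rightarrow> 'a \<Rightarrow> nat" where
  "right_steps S n \<omega> = card {k \<in> {1..n}. increment S k \<omega> = 1}"

(* The infimum of the empty set in enat is \<infinity>. *)
definition hitting_time :: "(nat \<Rightarrow> 'a \<Rightarrow> int) \<Rightarrow> nat \<Rightarrow> 'a \<Rightarrow> enat" where
  "hitting_time S d \<omega> = Inf {enat n | n. S n \<omega> = int d}"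

(* R_N / N at N = hitting_time S d. The value 0 on the event N = \<infinity>, which is null for
   p \<ge> 1/2, is an arbitrary convention. For d > 0 the hitting time is positive, so the division is
   a proper one. *)
definition right_step_ratio :: "(nat \<Rightarrow> 'a \<Rightarrow> int) \<Rightarrow> nat \<Rightarrow> 'a \<Rightarrow> real" where
  "right_step_ratio S d \<omega> =
     (case hitting_time S d \<omega> of
        enat n \<Rightarrow> real (right_steps S n \<omega>) / real n
      | \<infinity> \<Rightarrow> 0)"

end

theory Submission
  imports Defs
begin

text \<open>
  Almost surely \<open>R\<^bsub>N\<^esub> = (N + d) / 2\<close> at the hitting time \<open>N\<close>, so the expectation equals
  \<open>1/2 + (d/2) E[1/N]\<close>. Parametrise \<open>s = u / (p + q u\<^sup>2)\<close> with \<open>0 < u < 1\<close>. Stopping the exponential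
  martingale \<open>s\<^sup>n u\<^bsup>-S(n)\<^esup>\<close> at \<open>N\<close> gives the generating function \<open>E[s\<^sup>N] = u\<^sup>d\<close>, so with
  \<open>G(s) = E[s\<^sup>N / N]\<close> the function \<open>u\<^sup>d / 2 + (d/2) G(s(u))\<close> has derivative
  \<open>d u\<^bsup>d-1\<^esup> / (1 + (q/p) u\<^sup>2)\<close>, and its value at \<open>u = 1\<close> is the expectation. The two closed forms evaluate
  the resulting integral over \<open>[0, 1]\<close>: by recursion in \<open>d\<close> for odd \<open>d\<close>, by expanding \<open>(v - 1)\<^sup>m / v\<close> with
  \<open>v = 1 + (q/p) u\<^sup>2\<close> for \<open>d = 2m\<close>.
\<close>

section \<open>Analysis: from the generating function to an integral\<close>

text \<open>Weierstrass M-test with majorant \<open>\<bar>c n\<bar>\<close>. The endpoint 1 is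
  included, so limits at 1 may be taken inside the series.\<close>

lemma continuous_on_power_series_unit_interval:
  fixes c :: "nat \<Rightarrow> real"
  assumes "summable (\<lambda>n. \<bar>c n\<bar>)"
  shows "continuous_on {0..1} (\<lambda>x. \<Sum>n. c n * x ^ n)"
proof -
  have "uniform_limit {0..1} (\<lambda>n x. \<Sum>i<n. c i * x ^ i) (\<lambda>x. \<Sum>i. c i * x ^ i) sequentially"
    using assms
    by (intro Weierstrass_m_test)
      (auto simp: abs_mult power_abs intro!: mult_left_le power_le_one)
  then show ?thesis
    by (rule uniform_limit_theorem[rotated]) (auto intro!: continuous_intros always_eventually)
qed

text \<open>The bound by 1 rests on \<open>p + q * u\<^sup>2 - u = (1 - u) * (p - q * u)\<close>,
  whose second factor is positive because \<open>q \<le> p\<close>.\<close>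

lemma substitution_in_unit_interval:
  fixes p q u :: real
  assumes "1/2 \<le> p" "p < 1" "q = 1 - p" "0 < u" "u < 1"
  shows "0 < u / (p + q * u\<^sup>2)" "u / (p + q * u\<^sup>2) < 1"
proof -
  have pos: "0 < p + q * u\<^sup>2" using assms by (intro add_pos_nonneg) auto
  show "0 < u / (p + q * u\<^sup>2)" using pos assms by simp
  have "q * u < q * 1" using assms by (intro mult_strict_left_mono) auto
  then have "0 < (1 - u) * (p - q * u)" using assms(1-3,5) by (intro mult_pos_pos) linarith+
  also have "\<dots> = p + q * u\<^sup>2 - u"
    unfolding assms(3) by (simp add: algebra_simps power2_eq_square)
  finally show "u / (p + q * u\<^sup>2) < 1" using pos by simp
qed

text \<open>Free of probability: \<open>P\<close> stands for the mass function of the hitting time,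
  a priori possibly defective. Letting \<open>u\<close> tend to 1 in \<open>gf\<close> gives total
  mass 1; the integral comes from differentiating \<open>K\<close> below.\<close>

lemma hitting_law_integral:
  fixes P :: "nat \<Rightarrow> real" and p q :: real and d :: nat
  assumes p: "1/2 \<le> p" "p < 1" and q: "q = 1 - p" and d: "0 < d"
    and P: "\<And>n. 0 \<le> P n" "P 0 = 0" "summable P"
    and gf: "\<And>u. 0 < u \<Longrightarrow> u < 1 \<Longrightarrow> (\<lambda>n. P n * (u / (p + q * u\<^sup>2)) ^ n) sums (u ^ d)"
  shows "P sums 1"
    and "((\<lambda>u. real d * u ^ (d - 1) / (1 + q / p * u\<^sup>2)) has_integral
           (\<Sum>n. P n * ((real n + real d) / (2 * real n)))) {0..1}"
    and "summable (\<lambda>n. P n * ((real n + real d) / (2 * real n)))"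
proof -
  define s where "s u = u / (p + q * u\<^sup>2)" for u
  have den: "0 < p + q * u\<^sup>2" for u using p q by (intro add_pos_nonneg) auto
  have s_cont: "continuous_on {0..1} s"
    unfolding s_def using den by (intro continuous_intros) (metis less_irrefl)
  have s01: "0 < s u" "s u < 1" if "0 < u" "u < 1" for u
    using substitution_in_unit_interval[OF p q that] by (auto simp: s_def)
  have s_end: "s 0 = 0" "s 1 = 1" by (auto simp: s_def q)
  have s_unit: "s ` {0..1} \<subseteq> {0..1}"
  proof clarify
    fix u :: real assume "u \<in> {0..1}"
    then consider "u = 0" | "u = 1" | "0 < u \<and> u < 1" by force
    then show "s u \<in> {0..1}" using s_end s01[of u] by cases auto
  qed
  have gf': "(\<Sum>n. P n * s u ^ n) = u ^ d" if "0 < u" "u < 1" for u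
    using gf[OF that] by (simp add: s_def sums_iff)
  \<comment> \<open>Coefficients of \<open>G(s) = E[s^N / N]\<close>, with
    \<open>c 0 = 0\<close>.\<close>
  define c where "c n = P n / real n" for n
  have c_abs: "\<bar>c n\<bar> \<le> P n" for n
    using P(1)[of n] P(2) by (cases n) (auto simp: c_def field_simps)
  have c_sum: "summable (\<lambda>n. \<bar>c n\<bar>)"
    by (rule summable_comparison_test'[OF P(3)]) (use c_abs in auto)
  have P_cont: "continuous_on {0..1} (\<lambda>u. \<Sum>n. P n * s u ^ n)"
    using continuous_on_compose2[OF continuous_on_power_series_unit_interval s_cont s_unit, of P] P
    by simp
  have G_cont: "continuous_on {0..1} (\<lambda>u. \<Sum>n. c n * s u ^ n)"
    using continuous_on_compose2[OF continuous_on_power_series_unit_interval[OF c_sum] s_cont s_unit]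
    by simp
  have left: "at_left (1::real) = at 1 within {0..1}"
    using at_within_Icc_at_left[of 0 "1::real"] by simp
  \<comment> \<open>\<open>gf'\<close> holds only inside the interval, so the value at
    \<open>u = 1\<close> is found by computing the left limit twice: by continuity of the series and
    from \<open>u ^ d\<close>.\<close>
  have "((\<lambda>u. \<Sum>n. P n * s u ^ n) \<longlongrightarrow> (\<Sum>n. P n * s 1 ^ n)) (at_left 1)"
    using P_cont unfolding left continuous_on_def by force
  moreover have "((\<lambda>u. \<Sum>n. P n * s u ^ n) \<longlongrightarrow> 1) (at_left 1)"
  proof (rule Lim_transform_eventually)
    have "((\<lambda>u::real. u ^ d) \<longlongrightarrow> 1 ^ d) (at_left 1)" by (intro tendsto_intros)
    then show "((\<lambda>u::real. u ^ d) \<longlongrightarrow> 1) (at_left 1)" by simp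
    show "\<forall>\<^sub>F u in at_left 1. u ^ d = (\<Sum>n. P n * s u ^ n)"
      using eventually_at_left_real[of 0 "1::real"] by (auto elim!: eventually_mono simp: gf')
  qed
  ultimately have "(\<Sum>n. P n * s 1 ^ n) = 1"
    by (intro tendsto_unique[of "at_left (1::real)"]) auto
  then have P1: "(\<Sum>n. P n) = 1" by (simp add: s_end)
  then show "P sums 1" using P(3) by (simp add: sums_iff)
  \<comment> \<open>\<open>K\<close> goes from 0 at \<open>u = 0\<close> to the series in the
    conclusion at \<open>u = 1\<close>.\<close>
  define K where "K u = u ^ d / 2 + real d / 2 * (\<Sum>n. c n * s u ^ n)" for u
  have K_deriv: "(K has_real_derivative real d * u ^ (d - 1) / (1 + q / p * u\<^sup>2)) (at u)"
    if u: "u \<in> {0<..<1}" for u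
  proof -
    \<comment> \<open>This is \<open>s G'(s) = E[s^N] = u^d\<close>: \<open>diffs c n\<close> is
      \<open>P (Suc n)\<close>, and the index shift loses nothing because
      \<open>P 0 = 0\<close>.\<close>
    have "(\<Sum>n. diffs c n * s u ^ n) * s u = u ^ d"
    proof -
      have "summable (\<lambda>n. P n * s u ^ n)" using gf u by (auto simp: s_def sums_iff)
      then have "(\<Sum>n. P n * s u ^ n) = (\<Sum>n. P (Suc n) * s u ^ Suc n)"
        by (subst suminf_split_head) (simp_all add: P)
      moreover have "(\<Sum>n. P (Suc n) * s u ^ Suc n) = (\<Sum>n. diffs c n * s u ^ n * s u)"
        by (simp add: diffs_def c_def mult_ac)
      moreover have "summable (\<lambda>n. diffs c n * s u ^ n)"
      proof -
        have "summable (\<lambda>n. P (Suc n) * s u ^ Suc n)"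
          using \<open>summable (\<lambda>n. P n * s u ^ n)\<close>
          by (subst summable_Suc_iff[of "\<lambda>n. P n * s u ^ n"])
        then have "summable (\<lambda>n. diffs c n * s u ^ n * s u)"
          by (simp add: diffs_def c_def mult_ac)
        then show ?thesis using s01[of u] u
            using summable_mult2[of "\<lambda>n. diffs c n * s u ^ n * s u" "1 / s u"] by simp
      qed
      ultimately show ?thesis using gf'[of u] u by (simp add: suminf_mult2)
    qed
    then have e: "(\<Sum>n. diffs c n * s u ^ n) = u ^ d / s u"
      using s01[of u] u by (simp add: field_simps)
    have G: "((\<lambda>x. \<Sum>n. c n * x ^ n) has_real_derivative u ^ d / s u) (at (s u))"
      unfolding e[symmetric]
    proof (rule termdiffs_strong[of c 1])
      show "summable (\<lambda>n. c n * 1 ^ n)" using c_sum by (auto intro: summable_rabs_cancel)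
    qed (use s01[of u] u in auto)
    have ds: "(s has_real_derivative (p - q * u\<^sup>2) / (p + q * u\<^sup>2)\<^sup>2) (at u)"
      unfolding s_def using den[of u]
      by (auto intro!: derivative_eq_intros simp: field_simps power2_eq_square)
    have "(K has_real_derivative real d * u ^ (d - 1) / 2
        + real d / 2 * (u ^ d / s u * ((p - q * u\<^sup>2) / (p + q * u\<^sup>2)\<^sup>2))) (at u)"
      unfolding K_def using DERIV_chain2[OF G ds]
      by (auto intro!: derivative_eq_intros)
    moreover have "real d * u ^ (d - 1) / 2
        + real d / 2 * (u ^ d / s u * ((p - q * u\<^sup>2) / (p + q * u\<^sup>2)\<^sup>2))
        = real d * u ^ (d - 1) / (1 + q / p * u\<^sup>2)"
    proof -
      define D where "D = p + q * u\<^sup>2"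
      have D: "D > 0" using den by (simp add: D_def)
      have "1 + q / p * u\<^sup>2 = D / p" using p by (simp add: D_def field_simps)
      moreover have "u ^ d = u * u ^ (d - 1)" using d by (cases d) auto
      moreover have "p - q * u\<^sup>2 = 2 * p - D" by (simp add: D_def)
      \<comment> \<open>\<open>w\<close> stands for \<open>u ^ (d - 1)\<close>. The sum collapses by
        \<open>1 + (2 * p - D) / D = 2 * p / D\<close>.\<close>
      moreover have "real d * w / 2 + real d / 2 * (u * w / (u / D) * ((2 * p - D) / D\<^sup>2)) = real d * w / (D / p)" for w
        using u D p by (simp add: field_simps power2_eq_square)
      ultimately show ?thesis unfolding s_def D_def[symmetric] by metis
    qed
    ultimately show ?thesis by simp
  qed
  \<comment> \<open>The derivative of \<open>K\<close> is known only in the open interval; at the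
    endpoints continuity is enough.\<close>
  have "((\<lambda>u. real d * u ^ (d - 1) / (1 + q / p * u\<^sup>2)) has_integral (K 1 - K 0)) {0..1}"
  proof (rule fundamental_theorem_of_calculus_interior)
    show "continuous_on {0..1} K"
      unfolding K_def by (intro continuous_intros G_cont) simp
  qed (use K_deriv in \<open>auto simp: has_real_derivative_iff_has_vector_derivative\<close>)
  moreover have "K 0 = 0"
    using d powser_zero[of c] by (simp add: K_def s_end) (simp add: c_def)
  moreover have "P n * ((real n + real d) / (2 * real n)) = P n / 2 + real d / 2 * c n" for n
    using P(2) by (cases "n = 0") (auto simp: c_def field_simps)
  then have sm: "(\<lambda>n. P n * ((real n + real d) / (2 * real n))) sums (1 / 2 + real d / 2 * (\<Sum>n. c n))"
    using \<open>P sums 1\<close> summable_rabs_cancel[OF c_sum]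
    by (auto intro!: sums_add sums_mult sums_divide simp: summable_sums)
  ultimately show "((\<lambda>u. real d * u ^ (d - 1) / (1 + q / p * u\<^sup>2)) has_integral
           (\<Sum>n. P n * ((real n + real d) / (2 * real n)))) {0..1}"
    by (simp add: sums_iff K_def s_end)
  show "summable (\<lambda>n. P n * ((real n + real d) / (2 * real n)))" using sm by (simp add: sums_iff)
qed

section \<open>Closed forms of the two integrals\<close>

text \<open>Dividing \<open>u ^ (2 * j + 2)\<close> by the quadratic gives the recursion
  \<open>I (j + 1) = (1 / (2 * j + 1) - I j) / r\<close> for the integrals, and \<open>I 0\<close>
  is an arctangent.\<close>

lemma has_integral_even_power_over_quadratic:
  fixes r :: real
  assumes r: "0 < r"
  shows "((\<lambda>u. u ^ (2 * j) / (1 + r * u\<^sup>2)) has_integral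
    ((-1) ^ j * (1 / r) ^ j / sqrt r * arctan (sqrt r)
      - (\<Sum>k = 1..j. (-1) ^ k / (2 * real j + 1 - 2 * real k) * (1 / r) ^ k))) {0..1}"
proof (induction j)
  case 0
  have den: "1 + r * u\<^sup>2 > 0" for u using r by (intro add_pos_nonneg) auto
  have "((\<lambda>u. 1 / (1 + r * u\<^sup>2)) has_integral
      (arctan (sqrt r * 1) / sqrt r - arctan (sqrt r * 0) / sqrt r)) {0..1}"
  proof (rule fundamental_theorem_of_calculus)
    fix x :: real
    have "((\<lambda>u. arctan (sqrt r * u) / sqrt r) has_real_derivative 1 / (1 + r * x\<^sup>2)) (at x within {0..1})"
      using r real_sqrt_mult_self[of r]
      by (auto intro!: derivative_eq_intros simp: power_mult_distrib divide_simps simp del: real_sqrt_mult_self)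
    then show "((\<lambda>u. arctan (sqrt r * u) / sqrt r) has_vector_derivative 1 / (1 + r * x\<^sup>2)) (at x within {0..1})"
      by (simp add: has_real_derivative_iff_has_vector_derivative)
  qed simp
  then show ?case by simp
next
  case (Suc j)
  let ?I = "(-1) ^ j * (1 / r) ^ j / sqrt r * arctan (sqrt r)
      - (\<Sum>k = 1..j. (-1) ^ k / (2 * real j + 1 - 2 * real k) * (1 / r) ^ k)"
  have den: "1 + r * u\<^sup>2 > 0" for u using r by (intro add_pos_nonneg) auto
  have "((\<lambda>u::real. u ^ (2 * j)) has_integral (1 ^ Suc (2 * j) / real (Suc (2 * j)) - 0 ^ Suc (2 * j) / real (Suc (2 * j)))) {0..1}"
  proof (rule fundamental_theorem_of_calculus)
    fix x :: real
    have "((\<lambda>u. u ^ Suc (2 * j) / real (Suc (2 * j))) has_real_derivative x ^ (2 * j)) (at x within {0..1})"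
      by (rule derivative_eq_intros refl | simp del: power_Suc of_nat_Suc)+
    then show "((\<lambda>u. u ^ Suc (2 * j) / real (Suc (2 * j))) has_vector_derivative x ^ (2 * j)) (at x within {0..1})"
      by (simp add: has_real_derivative_iff_has_vector_derivative)
  qed simp
  then have "((\<lambda>u::real. u ^ (2 * j)) has_integral (1 / real (Suc (2 * j)))) {0..1}" by simp
  from has_integral_mult_right[OF has_integral_diff[OF this Suc.IH], of "1 / r"]
  have "((\<lambda>u. 1 / r * (u ^ (2 * j) - u ^ (2 * j) / (1 + r * u\<^sup>2))) has_integral
      (1 / r * (1 / real (Suc (2 * j)) - ?I))) {0..1}" .
  moreover have "1 / r * (u ^ (2 * j) - u ^ (2 * j) / (1 + r * u\<^sup>2)) = u ^ (2 * Suc j) / (1 + r * u\<^sup>2)" for u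
    using den[of u] r by (simp add: field_simps power2_eq_square)
  moreover have "1 / r * (1 / real (Suc (2 * j)) - ?I) =
      (-1) ^ Suc j * (1 / r) ^ Suc j / sqrt r * arctan (sqrt r)
      - (\<Sum>k = 1..Suc j. (-1) ^ k / (2 * real (Suc j) + 1 - 2 * real k) * (1 / r) ^ k)"
  proof -
    \<comment> \<open>The summand \<open>k = 1\<close> accounts for \<open>1 / (2 * j + 1)\<close>;
      the others are the old sum, shifted by one index and multiplied by
      \<open>- 1 / r\<close>.\<close>
    have "(\<Sum>k = 1..Suc j. (-1) ^ k / (2 * real (Suc j) + 1 - 2 * real k) * (1 / r) ^ k)
      = (-1) / (2 * real j + 1) * (1 / r)
        + (\<Sum>k = Suc 1..Suc j. (-1) ^ k / (2 * real (Suc j) + 1 - 2 * real k) * (1 / r) ^ k)"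
      by (subst sum.atLeast_Suc_atMost) (auto simp: algebra_simps)
    also have "(\<Sum>k = Suc 1..Suc j. (-1) ^ k / (2 * real (Suc j) + 1 - 2 * real k) * (1 / r) ^ k)
      = - (1 / r) * (\<Sum>k = 1..j. (-1) ^ k / (2 * real j + 1 - 2 * real k) * (1 / r) ^ k)"
      unfolding sum.shift_bounds_cl_Suc_ivl sum_distrib_left
      by (intro sum.cong) (auto simp: algebra_simps)
    finally show ?thesis by (simp add: algebra_simps)
  qed
  ultimately show ?case by simp
qed

text \<open>With \<open>v = 1 + r * u\<^sup>2\<close> the problem reduces to integrating
  \<open>(v - 1) ^ m / v\<close>, which the binomial theorem splits into powers of \<open>v\<close>
  and a multiple of \<open>1 / v\<close>.\<close>

lemma has_integral_odd_power_over_quadratic: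
  fixes r :: real
  assumes r: "0 < r" and m: "0 < m"
  shows "((\<lambda>u. 2 * real m * u ^ (2 * m - 1) / (1 + r * u\<^sup>2)) has_integral
    (1 - real m * (1 / r) ^ m * ((-1) ^ m * ln (1 + r)
      + (\<Sum>k = 1..m. (-1) ^ (m + k) * real (m choose k) * (((1 + r) ^ k - 1) / real k))))) {0..1}"
proof -
  \<comment> \<open>Termwise antiderivative of the expanded \<open>(v - 1) ^ m / v\<close>; the
    logarithm comes from the constant term of the binomial expansion.\<close>
  define F where "F v = (-1) ^ m * ln v + (\<Sum>k = 1..m. (-1) ^ (m + k) * real (m choose k) * (v ^ k / real k))" for v :: real
  have F: "(F has_real_derivative (v - 1) ^ m / v) (at v)" if v: "v > 0" for v
  proof -
    have "(F has_real_derivative (-1) ^ m * (1 / v) + (\<Sum>k = 1..m. (-1) ^ (m + k) * real (m choose k) * (real k * v ^ (k - 1) / real k))) (at v)"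
      unfolding F_def using v
      by (auto intro!: derivative_eq_intros simp: mult_ac)
    moreover have "(v - 1) ^ m = (-1) ^ m + v * (\<Sum>k = 1..m. (-1) ^ (m + k) * real (m choose k) * (real k * v ^ (k - 1) / real k))"
    proof -
      have "(v - 1) ^ m = (\<Sum>k\<le>m. real (m choose k) * v ^ k * (-1) ^ (m - k))"
        using binomial_ring[of v "-1" m] by simp
      also have "\<dots> = (-1) ^ m + (\<Sum>k = 1..m. real (m choose k) * v ^ k * (-1) ^ (m - k))"
        by (simp add: atMost_atLeast0 sum.atLeast_Suc_atMost)
      also have "(\<Sum>k = 1..m. real (m choose k) * v ^ k * (-1) ^ (m - k)) =
         v * (\<Sum>k = 1..m. (-1) ^ (m + k) * real (m choose k) * (real k * v ^ (k - 1) / real k))"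
        unfolding sum_distrib_left
      proof (intro sum.cong refl)
        fix k assume k: "k \<in> {1..m}"
        have "v ^ k = v * v ^ (k - 1)" using k by (cases k) auto
        moreover have "(-1 :: real) ^ (m - k) = (-1) ^ (m + k)"
          using k by (simp add: minus_one_power_iff)
        ultimately show "real (m choose k) * v ^ k * (-1) ^ (m - k) =
            v * ((-1) ^ (m + k) * real (m choose k) * (real k * v ^ (k - 1) / real k))"
          using k by simp
      qed
      finally show ?thesis .
    qed
    ultimately show ?thesis using v by (simp add: field_simps)
  qed
  have den: "1 + r * u\<^sup>2 > 0" for u using r by (intro add_pos_nonneg) auto
  \<comment> \<open>Write \<open>1 / v = 1 - r * u\<^sup>2 / v\<close>: the 1 integrates to
    \<open>u ^ (2 * m)\<close>, the rest to \<open>F v\<close>, where \<open>(1 / r) ^ m\<close>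
    undoes the \<open>r ^ m\<close> in \<open>(v - 1) ^ m\<close>.\<close>
  define H where "H u = u ^ (2 * m) - real m * (1 / r) ^ m * F (1 + r * u\<^sup>2)" for u
  have "((\<lambda>u. 2 * real m * u ^ (2 * m - 1) / (1 + r * u\<^sup>2)) has_integral (H 1 - H 0)) {0..1}"
  proof (rule fundamental_theorem_of_calculus)
    fix u :: real
    have "((\<lambda>u. 1 + r * u\<^sup>2) has_real_derivative 2 * r * u) (at u)"
      by (auto intro!: derivative_eq_intros)
    from DERIV_chain2[OF F[OF den] this]
    have FF: "((\<lambda>u. F (1 + r * u\<^sup>2)) has_real_derivative (1 + r * u\<^sup>2 - 1) ^ m / (1 + r * u\<^sup>2) * (2 * r * u)) (at u)" .
    have "(H has_real_derivative real (2 * m) * u ^ (2 * m - 1) -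
        real m * (1 / r) ^ m * ((1 + r * u\<^sup>2 - 1) ^ m / (1 + r * u\<^sup>2) * (2 * r * u))) (at u)"
      unfolding H_def by (rule derivative_eq_intros FF refl)+ simp
    moreover have "real (2 * m) * u ^ (2 * m - 1) -
        real m * (1 / r) ^ m * ((1 + r * u\<^sup>2 - 1) ^ m / (1 + r * u\<^sup>2) * (2 * r * u))
        = 2 * real m * u ^ (2 * m - 1) / (1 + r * u\<^sup>2)"
    proof -
      have "(1 / r) ^ m * (1 + r * u\<^sup>2 - 1) ^ m = u * u ^ (2 * m - 1)"
        using r m
        by (cases m) (simp_all add: power_mult_distrib power_one_over power2_eq_square power_mult)
      then have "real m * (1 / r) ^ m * ((1 + r * u\<^sup>2 - 1) ^ m / (1 + r * u\<^sup>2) * (2 * r * u))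
          = 2 * real m * r * u * (u * u ^ (2 * m - 1)) / (1 + r * u\<^sup>2)"
        by (simp add: mult_ac)
      moreover have "2 * real m * w - 2 * real m * r * u * (u * w) / (1 + r * u\<^sup>2) = 2 * real m * w / (1 + r * u\<^sup>2)" for w
        using den[of u] by (simp add: field_simps power2_eq_square)
      ultimately show ?thesis by (simp only: of_nat_mult of_nat_numeral)
    qed
    ultimately show "(H has_vector_derivative 2 * real m * u ^ (2 * m - 1) / (1 + r * u\<^sup>2)) (at u within {0..1})"
      by (metis has_real_derivative_iff_has_vector_derivative has_vector_derivative_at_within)
  qed simp
  moreover have "H 1 - H 0 = 1 - real m * (1 / r) ^ m * (F (1 + r) - F 1)"
    using m by (simp add: H_def algebra_simps)
  moreover have "F (1 + r) - F 1 = (-1) ^ m * ln (1 + r)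
      + (\<Sum>k = 1..m. (-1) ^ (m + k) * real (m choose k) * (((1 + r) ^ k - 1) / real k))"
    by (simp add: F_def sum_subtractf[symmetric] diff_divide_distrib right_diff_distrib)
  ultimately show ?thesis by simp
qed

section \<open>Path properties of the walk\<close>

context simple_random_walk
begin

lemma increment_measurable [measurable]:
  "n \<ge> 1 \<Longrightarrow> increment S n \<in> M \<rightarrow>\<^sub>M count_space UNIV"
  using indep_increments by (auto simp: indep_vars_def)

lemma walk_eq_sum:
  assumes "\<omega> \<in> space M"
  shows "S n \<omega> = (\<Sum>k = 1..n. increment S k \<omega>)"
  by (induction n) (auto simp: start[OF assms] increment_def)

text \<open>The locale gives measurability of the increments, through their independence; the walk
  inherits it by induction, starting from \<open>S 0\<close>, which is constant on
  \<open>space M\<close>.\<close>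

lemma walk_measurable [measurable]: "S n \<in> M \<rightarrow>\<^sub>M count_space UNIV"
proof (induction n)
  case 0
  then show ?case by (subst measurable_cong[OF start]) auto
next
  case (Suc n)
  note [measurable] = Suc
  have "(\<lambda>\<omega>. S n \<omega> + increment S (Suc n) \<omega>) \<in> M \<rightarrow>\<^sub>M count_space UNIV"
  proof (rule measurable_compose_countable[OF _ Suc])
    fix i :: int
    show "(\<lambda>\<omega>. i + increment S (Suc n) \<omega>) \<in> M \<rightarrow>\<^sub>M count_space UNIV"
      by (rule measurable_compose[OF increment_measurable]) auto
  qed
  then show ?case by (simp add: increment_def)
qed

text \<open>The two probabilities add up to 1, so every other step size is a null event; there are
  countably many steps.\<close>

lemma AE_increment: "AE \<omega> in M. \<forall>k\<ge>1. increment S k \<omega> = 1 \<or> increment S k \<omega> = -1"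
proof -
  have "AE \<omega> in M. increment S k \<omega> = 1 \<or> increment S k \<omega> = -1" if k: "k \<ge> 1" for k
  proof -
    note [measurable] = increment_measurable[OF k]
    have "prob ({\<omega> \<in> space M. increment S k \<omega> = 1} \<union> {\<omega> \<in> space M. increment S k \<omega> = -1}) = 1"
      using prob_up[OF k] prob_down[OF k] by (subst finite_measure_Union) auto
    then have "AE \<omega> in M. \<omega> \<in> {\<omega> \<in> space M. increment S k \<omega> = 1} \<union> {\<omega> \<in> space M. increment S k \<omega> = -1}"
      by (subst AE_in_set_eq_1) auto
    then show ?thesis by eventually_elim auto
  qed
  then show ?thesis by (subst AE_all_countable) auto
qed

text \<open>Unit steps cannot jump over the level \<open>d\<close>. This keeps the exponential
  martingale bounded before the hitting time.\<close>

lemma walk_less_before_hitting: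
  assumes "\<omega> \<in> space M" "0 < d" "\<forall>k\<ge>1. increment S k \<omega> = 1 \<or> increment S k \<omega> = -1"
    and "\<forall>k\<le>n. S k \<omega> \<noteq> int d"
  shows "S n \<omega> < int d"
  using assms(4)
proof (induction n)
  case 0
  then show ?case using assms start by simp
next
  case (Suc n)
  then have "S n \<omega> < int d" "S (Suc n) \<omega> \<noteq> int d" by auto
  moreover have "S (Suc n) \<omega> = S n \<omega> + 1 \<or> S (Suc n) \<omega> = S n \<omega> - 1"
    using assms(3)[rule_format, of "Suc n"] by (auto simp: increment_def)
  ultimately show ?case by linarith
qed

text \<open>Right steps minus left steps is \<open>S n\<close>, and together they number
  \<open>n\<close>. At the hitting time this gives \<open>R = (N + d) / 2\<close>.\<close>

lemma right_steps_eq: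
  assumes "\<omega> \<in> space M" "\<forall>k\<ge>1. increment S k \<omega> = 1 \<or> increment S k \<omega> = -1"
  shows "2 * int (right_steps S n \<omega>) = int n + S n \<omega>"
proof -
  have "S n \<omega> = (\<Sum>k = 1..n. 2 * of_bool (increment S k \<omega> = 1) - 1)"
    unfolding walk_eq_sum[OF assms(1)]
  proof (intro sum.cong refl)
    fix k assume "k \<in> {1..n}"
    then show "increment S k \<omega> = 2 * of_bool (increment S k \<omega> = 1) - 1"
      using assms(2)[rule_format, of k] by auto
  qed
  also have "\<dots> = 2 * int (right_steps S n \<omega>) - int n"
    by (simp add: right_steps_def sum_subtractf sum_distrib_left[symmetric] Int_def)
  finally show ?thesis by simp
qed

text \<open>A nonempty set in \<open>enat\<close> attains its infimum. The right-hand side involves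
  finitely many positions, which makes the event measurable.\<close>

lemma hitting_time_eq_iff:
  "hitting_time S d \<omega> = enat n \<longleftrightarrow> S n \<omega> = int d \<and> (\<forall>k<n. S k \<omega> \<noteq> int d)"
proof
  assume eq: "hitting_time S d \<omega> = enat n"
  then have ne: "{enat n | n. S n \<omega> = int d} \<noteq> {}"
    unfolding hitting_time_def by (intro notI) (simp add: Inf_enat_def)
  have "enat n \<in> {enat n | n. S n \<omega> = int d}"
    using eq wellorder_InfI[of _ "{enat n | n. S n \<omega> = int d}"] ne
    unfolding hitting_time_def by fastforce
  moreover have "S k \<omega> \<noteq> int d" if "k < n" for k
  proof
    assume "S k \<omega> = int d"
    then have "hitting_time S d \<omega> \<le> enat k" unfolding hitting_time_def by (intro Inf_lower) auto
    then show False using eq that by simp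
  qed
  ultimately show "S n \<omega> = int d \<and> (\<forall>k<n. S k \<omega> \<noteq> int d)" by auto
next
  assume h: "S n \<omega> = int d \<and> (\<forall>k<n. S k \<omega> \<noteq> int d)"
  show "hitting_time S d \<omega> = enat n"
    unfolding hitting_time_def
  proof (rule antisym)
    show "Inf {enat n | n. S n \<omega> = int d} \<le> enat n" using h by (intro Inf_lower) auto
    show "enat n \<le> Inf {enat n | n. S n \<omega> = int d}"
      using h by (intro Inf_greatest) (auto simp: not_less[symmetric])
  qed
qed

section \<open>Law of the hitting time\<close>

text \<open>Only finite times carry mass; almost sure finiteness is not presupposed but derived
  later from the generating function.\<close>

definition hitting_prob :: "nat \<Rightarrow> nat \<Rightarrow> real" where
  "hitting_prob d n = prob {\<omega> \<in> space M. hitting_time S d \<omega> = enat n}"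

lemma hitting_event_measurable [measurable]: "{\<omega> \<in> space M. hitting_time S d \<omega> = enat n} \<in> events"
  unfolding hitting_time_eq_iff by measurable

lemma summable_hitting_prob: "summable (hitting_prob d)"
proof -
  have "(\<lambda>n. prob {\<omega> \<in> space M. hitting_time S d \<omega> = enat n}) sums
      prob (\<Union>n. {\<omega> \<in> space M. hitting_time S d \<omega> = enat n})"
    by (rule finite_measure_UNION) (auto simp: disjoint_family_on_def)
  then show ?thesis unfolding hitting_prob_def[abs_def] by (rule sums_summable)
qed

lemma hitting_prob_nonneg: "0 \<le> hitting_prob d n"
  by (simp add: hitting_prob_def)

lemma hitting_prob_0: "0 < d \<Longrightarrow> hitting_prob d 0 = 0"
proof -
  assume "0 < d"
  then have "{\<omega> \<in> space M. hitting_time S d \<omega> = enat 0} = {}"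
    by (auto simp: hitting_time_eq_iff start)
  then show ?thesis by (simp only: hitting_prob_def measure_empty)
qed

text \<open>
  Here \<open>a n\<close> is the contribution to the stopped martingale of the paths that have not yet hit \<open>d\<close>. It is
  written with sums of increments rather than \<open>S n\<close> because these are functions of the increments
  outside \<open>space M\<close> as well.
\<close>
lemma exp_martingale_sum:
  fixes u :: real
  assumes d: "0 < d" and u: "0 < u" "u < 1"
  defines "s \<equiv> u / (p + (1 - p) * u\<^sup>2)"
  defines "a \<equiv> \<lambda>n. expectation (\<lambda>\<omega>. s ^ n * u powr (- real_of_int (\<Sum>k = 1..n. increment S k \<omega>))
      * of_bool (\<forall>j\<le>n. (\<Sum>k = 1..j. increment S k \<omega>) \<noteq> int d))"
  assumes s: "0 < s" "s < 1"
  shows "0 \<le> a n" "a n \<le> s ^ n * u powr (- real d)"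
    "a n + (\<Sum>k\<le>n. hitting_prob d k * s ^ k) * u powr (- real d) = 1"
proof -
  \<comment> \<open>\<open>f n\<close> reads only the coordinates \<open>1..n\<close>, so that
    \<open>W n\<close> is a function of the first \<open>n\<close> increments and hence independent
    of \<open>Y (Suc n)\<close>.\<close>
  define f where "f n x = s ^ n * u powr (- (\<Sum>k = 1..n. real_of_int (x k)))
      * of_bool (\<forall>j\<le>n. (\<Sum>k = 1..j. real_of_int (x k)) \<noteq> real d)" for n and x :: "nat \<Rightarrow> int"
  define W where "W n \<omega> = f n (\<lambda>k. increment S k \<omega>)" for n \<omega>
  \<comment> \<open>The factor gained in step \<open>n\<close>; \<open>s\<close> is chosen to give
    it mean 1.\<close>
  define Y where "Y n \<omega> = s * u powr (- real_of_int (increment S n \<omega>))" for n \<omega>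
  have sum_of_int: "(\<Sum>k = 1..j. real_of_int (x k)) = real d \<longleftrightarrow> (\<Sum>k = 1..j. x k) = int d" for j x
    by (metis of_int_sum of_int_of_nat_eq of_int_eq_iff)
  have a_eq: "a n = expectation (W n)" for n
    unfolding a_def W_def f_def sum_of_int by simp
  have W_walk: "W n \<omega> = s ^ n * u powr (- real_of_int (S n \<omega>)) * of_bool (\<forall>j\<le>n. S j \<omega> \<noteq> int d)"
    if "\<omega> \<in> space M" for n \<omega>
    unfolding W_def f_def sum_of_int walk_eq_sum[OF that] by simp
  have f_measurable: "f n \<in> borel_measurable (Pi\<^sub>M {1..n} (\<lambda>_. count_space UNIV))" for n
  proof -
    have [measurable]: "(\<lambda>x. \<Sum>k = 1..j. real_of_int (x k)) \<in> borel_measurable (Pi\<^sub>M {1..n} (\<lambda>_. count_space UNIV))"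
      if "j \<le> n" for j
      using that
      by (intro borel_measurable_sum measurable_compose[OF measurable_component_singleton]) auto
    have [measurable]: "Measurable.pred (Pi\<^sub>M {1..n} (\<lambda>_. count_space UNIV))
        (\<lambda>x. \<forall>j\<le>n. (\<Sum>k = 1..j. real_of_int (x k)) \<noteq> real d)"
      unfolding Ball_def[symmetric] atMost_iff[symmetric]
      by (intro pred_intros_finite) auto
    show ?thesis unfolding f_def by measurable
  qed
  have f_restrict: "f n (restrict (\<lambda>k. increment S k \<omega>) {1..n}) = W n \<omega>" for n \<omega>
  proof -
    have "(\<Sum>k = 1..j. real_of_int (restrict (\<lambda>k. increment S k \<omega>) {1..n} k))
        = (\<Sum>k = 1..j. real_of_int (increment S k \<omega>))" if "j \<le> n" for j
      using that by (intro sum.cong) auto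
    then show ?thesis unfolding W_def f_def by simp
  qed
  have indep: "indep_var borel (W n) borel (Y (Suc n))" for n
  proof -
    have "indep_var borel (f n \<circ> (\<lambda>\<omega>. restrict (\<lambda>k. increment S k \<omega>) {1..n}))
        borel ((\<lambda>x. s * u powr (- real_of_int (x (Suc n)))) \<circ> (\<lambda>\<omega>. restrict (\<lambda>k. increment S k \<omega>) {Suc n}))"
    proof (rule indep_var_compose[OF indep_var_restrict[OF indep_increments]])
      show "(\<lambda>x. s * u powr (- real_of_int (x (Suc n)))) \<in>
          borel_measurable (Pi\<^sub>M {Suc n} (\<lambda>_. count_space UNIV))"
        by (rule measurable_compose[OF measurable_component_singleton]) auto
    qed (use f_measurable[of n] in auto)
    moreover have "(\<lambda>\<omega>. s * u powr (- real_of_int (restrict (\<lambda>k. increment S k \<omega>) {Suc n} (Suc n)))) = Y (Suc n)"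
      by (simp add: Y_def fun_eq_iff)
    ultimately show ?thesis unfolding comp_def f_restrict by simp
  qed
  have W_meas [measurable]: "W n \<in> borel_measurable M" for n
    using indep[of n] by (rule indep_var_rv1)
  have Y_meas [measurable]: "Y (Suc n) \<in> borel_measurable M" for n
    using indep[of n] by (rule indep_var_rv2)
  have W_nonneg: "0 \<le> W n \<omega>" for n \<omega> using s u by (simp add: W_def f_def)
  \<comment> \<open>Until \<open>d\<close> is hit the walk stays below \<open>d\<close>, and
    \<open>u < 1\<close> turns this into a bound uniform over the paths.\<close>
  have W_bound: "AE \<omega> in M. W n \<omega> \<le> s ^ n * u powr (- real d)" for n
    using AE_increment AE_space
  proof eventually_elim
    fix \<omega> assume w: "\<forall>k\<ge>1. increment S k \<omega> = 1 \<or> increment S k \<omega> = - 1" "\<omega> \<in> space M"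
    show "W n \<omega> \<le> s ^ n * u powr (- real d)"
    proof (cases "\<forall>j\<le>n. S j \<omega> \<noteq> int d")
      case True
      then have "S n \<omega> < int d" using walk_less_before_hitting w d by blast
      then have "- real d \<le> - real_of_int (S n \<omega>)" by linarith
      then have "u powr (- real_of_int (S n \<omega>)) \<le> u powr (- real d)"
        using u by (intro powr_mono') auto
      then show ?thesis using s True by (simp add: W_walk[OF w(2)])
    next
      case False
      then show ?thesis using s by (simp only: W_walk[OF w(2)]) simp
    qed
  qed
  have W_int: "integrable M (W n)" for n
    using W_bound[of n] W_nonneg
    by (intro integrable_const_bound[where B = "s ^ n * u powr (- real d)"]) auto
  have Y_AE: "AE \<omega> in M. Y (Suc n) \<omega> = s / u * indicator {\<omega> \<in> space M. increment S (Suc n) \<omega> = 1} \<omega>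
      + s * u * indicator {\<omega> \<in> space M. increment S (Suc n) \<omega> = -1} \<omega>" for n
    using AE_increment AE_space
  proof eventually_elim
    fix \<omega> assume w: "\<forall>k\<ge>1. increment S k \<omega> = 1 \<or> increment S k \<omega> = - 1" "\<omega> \<in> space M"
    have "increment S (Suc n) \<omega> = 1 \<or> increment S (Suc n) \<omega> = - 1" using w(1) by simp
    then show "Y (Suc n) \<omega> = s / u * indicator {\<omega> \<in> space M. increment S (Suc n) \<omega> = 1} \<omega>
      + s * u * indicator {\<omega> \<in> space M. increment S (Suc n) \<omega> = -1} \<omega>"
      using w(2) u by (auto simp: Y_def powr_minus_divide)
  qed
  have [measurable]: "increment S (Suc n) \<in> M \<rightarrow>\<^sub>M count_space UNIV" for n
    by (rule increment_measurable) simp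
  have Y_hbi: "has_bochner_integral M (Y (Suc n)) (s / u * p + s * u * (1 - p))" for n
  proof -
    have "has_bochner_integral M (\<lambda>\<omega>. s / u * indicator {\<omega> \<in> space M. increment S (Suc n) \<omega> = 1} \<omega>
        + s * u * indicator {\<omega> \<in> space M. increment S (Suc n) \<omega> = -1} \<omega>)
        (s / u * prob {\<omega> \<in> space M. increment S (Suc n) \<omega> = 1}
          + s * u * prob {\<omega> \<in> space M. increment S (Suc n) \<omega> = -1})"
      by (intro has_bochner_integral_add has_bochner_integral_mult_right
          has_bochner_integral_real_indicator) (auto simp: less_top[symmetric])
    then show ?thesis
      by (subst has_bochner_integral_cong_AE[OF _ _ Y_AE]) (simp_all add: prob_up prob_down)
  qed
  then have Y_int: "integrable M (Y (Suc n))" for n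
    by (auto simp: has_bochner_integral_iff)
  \<comment> \<open>\<open>s\<close> solves \<open>s * (p / u + (1 - p) * u) = 1\<close>; its
    positivity excludes a zero denominator in \<open>s_def\<close>.\<close>
  have Y_exp: "expectation (Y (Suc n)) = 1" for n
  proof -
    have "expectation (Y (Suc n)) = s / u * p + s * u * (1 - p)"
      using Y_hbi by (rule has_bochner_integral_integral_eq)
    also have "\<dots> = s * ((p + (1 - p) * u\<^sup>2) / u)"
      using u by (simp add: field_simps power2_eq_square)
    also have "\<dots> = 1"
      using s(1) u unfolding s_def by (auto simp: zero_less_divide_iff)
    finally show ?thesis .
  qed
  show nonneg: "0 \<le> a n" for n
    unfolding a_eq by (intro integral_nonneg_AE) (simp add: W_nonneg)
  show "a n \<le> s ^ n * u powr (- real d)" for n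
    unfolding a_eq using integral_le_const[OF W_int W_bound] .
  have step: "a n = a (Suc n) + hitting_prob d (Suc n) * s ^ Suc n * u powr (- real d)" for n
  proof -
    let ?H = "{\<omega> \<in> space M. hitting_time S d \<omega> = enat (Suc n)}"
    \<comment> \<open>A path avoiding \<open>d\<close> up to time \<open>n\<close> either avoids it
      at \<open>Suc n\<close> too or hits it there with weight
      \<open>s ^ Suc n * u powr (- real d)\<close>; a path that hit earlier contributes 0 to both
      sides.\<close>
    have "W n \<omega> * Y (Suc n) \<omega> = W (Suc n) \<omega> + s ^ Suc n * u powr (- real d) * indicator ?H \<omega>"
      if w: "\<omega> \<in> space M" for \<omega>
    proof (cases "\<forall>j\<le>n. S j \<omega> \<noteq> int d")
      case True
      have "W n \<omega> * Y (Suc n) \<omega> = s ^ Suc n * u powr (- real_of_int (S (Suc n) \<omega>))"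
        using True u by (simp add: W_walk[OF w] Y_def increment_def powr_add[symmetric])
      then show ?thesis
        using True w by (auto simp: W_walk[OF w] hitting_time_eq_iff le_Suc_eq less_Suc_eq_le)
    next
      case False
      then have "\<not> (\<forall>j\<le>Suc n. S j \<omega> \<noteq> int d)" using le_SucI by blast
      moreover have "\<omega> \<notin> ?H" using False by (auto simp: hitting_time_eq_iff less_Suc_eq_le)
      moreover note False
      ultimately show ?thesis by (simp only: W_walk[OF w]) simp
    qed
    then have "expectation (\<lambda>\<omega>. W n \<omega> * Y (Suc n) \<omega>) =
        expectation (\<lambda>\<omega>. W (Suc n) \<omega> + s ^ Suc n * u powr (- real d) * indicator ?H \<omega>)"
      by (intro Bochner_Integration.integral_cong) auto
    also have "\<dots> = a (Suc n) + hitting_prob d (Suc n) * s ^ Suc n * u powr (- real d)"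
      by (subst Bochner_Integration.integral_add)
         (auto simp: W_int a_eq hitting_prob_def less_top[symmetric])
    finally show ?thesis
      by (simp add: indep_var_lebesgue_integral[OF indep W_int Y_int] Y_exp a_eq)
  qed
  show "a n + (\<Sum>k\<le>n. hitting_prob d k * s ^ k) * u powr (- real d) = 1" for n
  proof (induction n)
    case 0
    have "a 0 = 1" using d u by (simp add: a_def prob_space)
    then show ?case by (simp add: hitting_prob_0[OF d])
  next
    case (Suc n)
    then show ?case using step[of n] by (simp add: algebra_simps)
  qed
qed

text \<open>Solve the martingale identity for the partial sums. The paths that have not hit by time
  \<open>n\<close> contribute at most \<open>s ^ n * u powr (- real d)\<close>, which tends to 0 as
  \<open>s < 1\<close>.\<close>

lemma hitting_generating_function:
  fixes u :: real
  assumes d: "0 < d" and u: "0 < u" "u < 1"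
    and s: "s = u / (p + (1 - p) * u\<^sup>2)" "0 < s" "s < 1"
  shows "(\<lambda>n. hitting_prob d n * s ^ n) sums (u ^ d)"
proof -
  note m = exp_martingale_sum[OF d u s(2,3)[unfolded s(1)], folded s(1)]
  \<comment> \<open>By the identity in \<open>m\<close> this is the contribution of the paths that
    have not hit yet, whence both bounds.\<close>
  define a where "a n = 1 - (\<Sum>k\<le>n. hitting_prob d k * s ^ k) * u powr (- real d)" for n
  have a: "0 \<le> a n" "a n \<le> s ^ n * u powr (- real d)" for n
    using m[of n] by (auto simp: a_def)
  have "a \<longlonglongrightarrow> 0"
  proof (rule tendsto_sandwich[OF _ _ tendsto_const])
    have "(\<lambda>n. s ^ n * u powr (- real d)) \<longlonglongrightarrow> 0 * u powr (- real d)"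
      using s(2,3) by (intro tendsto_mult_right LIMSEQ_power_zero) simp
    then show "(\<lambda>n. s ^ n * u powr (- real d)) \<longlonglongrightarrow> 0" by simp
  qed (use a in auto)
  then have "(\<lambda>n. (1 - a n) * u powr real d) \<longlonglongrightarrow> (1 - 0) * u powr real d"
    by (intro tendsto_intros)
  moreover have "(1 - a n) * u powr real d = (\<Sum>k\<le>n. hitting_prob d k * s ^ k)" for n
    using u by (simp add: a_def mult.assoc powr_add[symmetric])
  ultimately show ?thesis
    using u by (simp add: sums_def_le powr_realpow)
qed

section \<open>The expectation as a series over hitting times\<close>

text \<open>The ratio is a countable sum over the possible hitting times; if \<open>d\<close> is
  never hit all summands vanish, in agreement with the default value 0.\<close>

lemma right_step_ratio_measurable: "right_step_ratio S d \<in> borel_measurable M"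
proof -
  let ?f = "\<lambda>n \<omega>. indicator {\<omega> \<in> space M. hitting_time S d \<omega> = enat n} \<omega>
      * (real (right_steps S n \<omega>) / real n)"
  have [measurable]: "(\<lambda>\<omega>. real (right_steps S n \<omega>)) \<in> borel_measurable M" for n
  proof -
    have "real (right_steps S n \<omega>) = (\<Sum>k = 1..n. of_bool (increment S k \<omega> = 1))" for \<omega>
      by (simp add: right_steps_def Int_def)
    moreover have "(\<lambda>\<omega>. \<Sum>k = 1..n. of_bool (increment S k \<omega> = 1) :: real) \<in> borel_measurable M"
      by (intro borel_measurable_sum measurable_compose[OF increment_measurable]) auto
    ultimately show ?thesis by simp
  qed
  have "right_step_ratio S d \<omega> = (\<Sum>n. ?f n \<omega>)" if "\<omega> \<in> space M" for \<omega>
  proof (cases "hitting_time S d \<omega>")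
    case (enat n)
    then have "(\<Sum>n. ?f n \<omega>) = (\<Sum>n\<in>{n}. ?f n \<omega>)" by (intro suminf_finite) auto
    then show ?thesis using enat that by (simp add: right_step_ratio_def)
  next
    case infinity
    then show ?thesis by (simp add: right_step_ratio_def)
  qed
  moreover have "(\<lambda>\<omega>. \<Sum>n. ?f n \<omega>) \<in> borel_measurable M" by measurable
  ultimately show ?thesis by (simp cong: measurable_cong)
qed

text \<open>On the event \<open>N = n\<close> the ratio is almost surely
  \<open>(n + d) / (2 * n)\<close>. The terms are nonnegative, so \<open>sm\<close> permits
  integration term by term.\<close>

lemma expectation_right_step_ratio:
  assumes P1: "hitting_prob d sums 1" and d: "0 < d"
    and sm: "summable (\<lambda>n. hitting_prob d n * ((real n + real d) / (2 * real n)))"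
  shows "expectation (right_step_ratio S d) =
    (\<Sum>n. hitting_prob d n * ((real n + real d) / (2 * real n)))"
proof -
  let ?H = "\<lambda>n. {\<omega> \<in> space M. hitting_time S d \<omega> = enat n}"
  let ?c = "\<lambda>n. (real n + real d) / (2 * real n)"
  let ?g = "\<lambda>n \<omega>. indicator (?H n) \<omega> * ?c n"
  \<comment> \<open>Total mass 1 says precisely that the hitting time is almost surely
    finite.\<close>
  have "(\<lambda>n. prob (?H n)) sums prob (\<Union>n. ?H n)"
    by (rule finite_measure_UNION) (auto simp: disjoint_family_on_def)
  then have "prob (\<Union>n. ?H n) = 1"
    using P1 unfolding hitting_prob_def[abs_def] by (rule sums_unique2)
  then have fin: "AE \<omega> in M. \<omega> \<in> (\<Union>n. ?H n)"
    by (subst AE_in_set_eq_1) auto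
  have g_sums: "?g k \<omega> = 0" if "hitting_time S d \<omega> = enat n" "k \<noteq> n" for \<omega> n k
    using that by simp
  have g_one: "(\<lambda>k. ?g k \<omega>) sums ?g n \<omega>" if "hitting_time S d \<omega> = enat n" for \<omega> n
    using sums_finite[of "{n}" "\<lambda>k. ?g k \<omega>"] g_sums[OF that] by simp
  have g_sum: "AE \<omega> in M. (\<lambda>n. ?g n \<omega>) sums right_step_ratio S d \<omega>"
    using fin AE_increment
  proof eventually_elim
    fix \<omega> assume "\<omega> \<in> (\<Union>n. ?H n)" and inc: "\<forall>k\<ge>1. increment S k \<omega> = 1 \<or> increment S k \<omega> = - 1"
    then obtain n where n: "\<omega> \<in> space M" "hitting_time S d \<omega> = enat n" by auto
    have "2 * int (right_steps S n \<omega>) = int n + int d"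
      using right_steps_eq[OF n(1) inc] n(2) by (simp add: hitting_time_eq_iff)
    then have rs: "2 * real (right_steps S n \<omega>) = real n + real d"
      by (simp flip: of_int_eq_iff[where 'a = real])
    have "real (right_steps S n \<omega>) / real n = ?c n" by (simp flip: rs)
    then show "(\<lambda>k. ?g k \<omega>) sums right_step_ratio S d \<omega>"
      using g_one[OF n(2)] n by (simp add: right_step_ratio_def)
  qed
  have g_int: "integrable M (?g n)" for n
    by (auto simp: less_top[symmetric])
  have g_exp: "expectation (?g n) = hitting_prob d n * ?c n" for n
    by (simp add: hitting_prob_def)
  have "expectation (right_step_ratio S d) = expectation (\<lambda>\<omega>. \<Sum>n. ?g n \<omega>)"
  proof (rule integral_cong_AE)
    show "AE \<omega> in M. right_step_ratio S d \<omega> = (\<Sum>n. ?g n \<omega>)"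
      using g_sum by eventually_elim (simp add: sums_iff)
    show "right_step_ratio S d \<in> borel_measurable M" by (rule right_step_ratio_measurable)
  qed auto
  also have "\<dots> = (\<Sum>n. expectation (?g n))"
  proof (rule integral_suminf[OF g_int])
    show "AE \<omega> in M. summable (\<lambda>n. norm (?g n \<omega>))"
      using g_sum by eventually_elim (simp add: sums_iff)
    show "summable (\<lambda>n. expectation (\<lambda>\<omega>. norm (?g n \<omega>)))"
      using sm by (simp add: hitting_prob_def)
  qed
  finally show ?thesis by (simp only: g_exp)
qed

end

section \<open>Evaluation for odd and even \<open>d\<close>\<close>

theorem theorem3p1:
  fixes M :: "'a measure" and S :: "nat \<Rightarrow> 'a \<Rightarrow> int" and p q :: real and d :: nat
  assumes "1/2 \<le> p" and "p < 1"
    and "q = 1 - p"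
    and "0 < d"
    and "simple_random_walk M S p"
  shows "(odd d \<longrightarrow>
      prob_space.expectation M (right_step_ratio S d) =
        (-1) ^ ((d - 1) div 2) * real d * (p / q) powr (real d / 2) * arctan (sqrt (q / p))
        + 1
        - real d * (\<Sum>k = 0..(d - 1) div 2. (-1) ^ k / (real d - 2 * real k) * (p / q) ^ k))
    \<and> (even d \<longrightarrow>
      prob_space.expectation M (right_step_ratio S d) =
        (-1) ^ (d div 2) * (real d / 2) * (p / q) powr (real d / 2) * ln p
        + 1
        - (real d / 2) * (p / q) powr (real d / 2) *
          (\<Sum>k = 1..d div 2. (-1) ^ (d div 2 + k) * real ((d div 2) choose k)
             * ((p powi (- int k) - 1) / real k)))"
proof -
  interpret simple_random_walk M S p by fact
  let ?E = "expectation (right_step_ratio S d)"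
  have gf: "(\<lambda>n. hitting_prob d n * (u / (p + q * u\<^sup>2)) ^ n) sums (u ^ d)" if u: "0 < u" "u < 1" for u
    using hitting_generating_function[OF assms(4) u] substitution_in_unit_interval[OF assms(1-3) u]
    by (simp add: assms(3))
  note law = hitting_law_integral[OF assms(1-4) hitting_prob_nonneg
      hitting_prob_0[OF assms(4)] summable_hitting_prob gf]
  have E: "((\<lambda>u. real d * u ^ (d - 1) / (1 + q / p * u\<^sup>2)) has_integral ?E) {0..1}"
    using law(2) expectation_right_step_ratio[OF law(1) assms(4) law(3)] by simp
  have pq: "0 < p" "0 < q" "0 < q / p" "0 < p / q" using assms by auto
  show ?thesis
  proof (intro conjI impI)
    assume "odd d"
    then obtain j where d: "d = 2 * j + 1" by (rule oddE)
    have "((\<lambda>u. real d * (u ^ (2 * j) / (1 + q / p * u\<^sup>2))) has_integral ?E) {0..1}"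
      using E by (simp add: d)
    from has_integral_unique[OF this has_integral_mult_right[OF has_integral_even_power_over_quadratic[OF pq(3)]]]
    have "?E = real d * ((-1) ^ j * (p / q) ^ j / sqrt (q / p) * arctan (sqrt (q / p))
        - (\<Sum>k = 1..j. (-1) ^ k / (2 * real j + 1 - 2 * real k) * (p / q) ^ k))"
      by simp
    moreover have "(p / q) powr (real d / 2) = (p / q) ^ j / sqrt (q / p)"
    proof -
      have "real d / 2 = real j + 1 / 2" by (simp add: d)
      have "(p / q) powr (real d / 2) = (p / q) ^ j * sqrt (p / q)"
        unfolding \<open>real d / 2 = _\<close> using pq by (simp add: powr_add powr_realpow powr_half_sqrt)
      then show ?thesis by (simp add: real_sqrt_divide)
    qed
    \<comment> \<open>The term \<open>k = 0\<close>, multiplied by \<open>d\<close>, is 1 and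
      cancels the \<open>+ 1\<close> of the closed form.\<close>
    moreover have "(\<Sum>k = 0..j. (-1) ^ k / (real d - 2 * real k) * (p / q) ^ k)
        = 1 / real d + (\<Sum>k = 1..j. (-1) ^ k / (2 * real j + 1 - 2 * real k) * (p / q) ^ k)"
      by (subst sum.atLeast_Suc_atMost) (simp_all add: d add.commute)
    moreover have "(d - 1) div 2 = j" by (simp add: d)
    ultimately show "?E = (-1) ^ ((d - 1) div 2) * real d * (p / q) powr (real d / 2) * arctan (sqrt (q / p))
        + 1
        - real d * (\<Sum>k = 0..(d - 1) div 2. (-1) ^ k / (real d - 2 * real k) * (p / q) ^ k)"
      using assms(4) by (simp add: algebra_simps)
  next
    assume "even d"
    then obtain m where d: "d = 2 * m" by (rule evenE)
    have m: "0 < m" using assms(4) d by simp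
    \<comment> \<open>With \<open>r = q / p\<close>, this turns \<open>ln (1 + r)\<close> into
      \<open>- ln p\<close> and \<open>(1 + r) ^ k\<close> into
      \<open>p powi (- int k)\<close>.\<close>
    have r: "1 + q / p = 1 / p" using pq assms(3) by (simp add: field_simps)
    have "((\<lambda>u. 2 * real m * u ^ (2 * m - 1) / (1 + q / p * u\<^sup>2)) has_integral ?E) {0..1}"
      using E by (simp add: d)
    from has_integral_unique[OF this has_integral_odd_power_over_quadratic[OF pq(3) m]]
    have "?E = 1 - real m * (p / q) ^ m * ((-1) ^ m * ln (1 / p)
      + (\<Sum>k = 1..m. (-1) ^ (m + k) * real (m choose k) * (((1 / p) ^ k - 1) / real k)))"
      unfolding r by simp
    moreover have "(1 / p) ^ k = p powi (- int k)" for k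
      by (simp add: power_int_minus power_one_over inverse_eq_divide)
    moreover have "ln (1 / p) = - ln p" using pq by (simp add: ln_div)
    moreover have "(p / q) powr (real d / 2) = (p / q) ^ m"
      using pq by (simp add: d powr_realpow)
    moreover have "d div 2 = m" "real d / 2 = real m" by (auto simp: d)
    ultimately show "?E = (-1) ^ (d div 2) * (real d / 2) * (p / q) powr (real d / 2) * ln p
        + 1
        - (real d / 2) * (p / q) powr (real d / 2) *
          (\<Sum>k = 1..d div 2. (-1) ^ (d div 2 + k) * real ((d div 2) choose k)
             * ((p powi (- int k) - 1) / real k))"
      by (simp only:) (simp add: algebra_simps)
  qed
qed

end
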